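(* Let $\mathcal{H}$ be a complex separable Hilbert space, let $\mathcal{M}$ be a closed subspace of $\mathcal{H}$ and let $\mathcal{N}$ be a (not necessarily closed) subspace of $\mathcal{H}$. Then $$P_{\mathcal{M},\mathcal{N}}=\begin{pmatrix} I & x\\ 0 & 0\end{pmatrix}_{\mathcal{M}},\qquad\text{where } x=-P_{\mathcal{M}}\,(P_{\mathcal{M}^{\perp}}|_{\mathcal{N}})^{-1},$$ $x$ being regarded as a linear relation from $\mathcal{M}^\perp$ to $\mathcal{M}$.
   Context: A linear relation from $\mathcal{H}$ to $\mathcal{K}$ is a linear subspace $T$ of $\mathcal{H}\times\mathcal{K}$; operators are identified with their graphs. Subspaces need not be closed unless stated. $T^{-1}=\{(y,x):(x,y)\in T\}$, $-T=\{(u,-v):(u,v)\in T\}$, $RT=\{(x,y): (x,z)\in T,\ (z,y)\in R\text{ for some }z\}$, and $T|_{\mathcal{N}}=\{(x,y)\in T: x\in\mathcal{N}\}$. For subspaces $\mathcal{M},\mathcal{N}$ of $\mathcal{H}$, $P_{\mathcal{M},\mathcal{N}}:=\{(m+n,m): m\in\mathcal{M},\ n\in\mathcal{N}\}$ is the multivalued projection with range $\mathcal{M}$ and kernel $\mathcal{N}$. For a closed subspace $\mathcal{S}$, $P_{\mathcal{S}}$ is the orthogonal projection onto $\mathcal{S}$. Block matrices: for a closed subspace $\mathcal{S}$ of $\mathcal{H}$ and linear relations $a$ from $\mathcal{S}$ to $\mathcal{S}$, $b$ from $\mathcal{S}^\perp$ to $\mathcal{S}$, $c$ from $\mathcal{S}$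 to $\mathcal{S}^\perp$, $d$ from $\mathcal{S}^\perp$ to $\mathcal{S}^\perp$, $$\begin{pmatrix} a&b\\c&d\end{pmatrix}_{\mathcal{S}}:=\{(x_1+x_2,(w_1+z_1)+(w_2+z_2)):(x_1,w_1)\in a,\ (x_2,z_1)\in b,\ (x_1,w_2)\in c,\ (x_2,z_2)\in d\},$$ a linear relation in $\mathcal{H}\times\mathcal{H}$. Entries $I$ and $0$ denote the everywhere defined identity and zero operators between the corresponding subspaces. Equality is equality of linear relations. *)

theory Defs
  imports "HOL-Analysis.Analysis"
begin

section \<open>Complex Hilbert spaces\<close>

class complex_vector = real_vector +
  fixes scaleC :: "complex \<Rightarrow> 'a \<Rightarrow> 'a"  (infixr \<open>*\<^sub>C\<close> 75)
  assumes scaleC_add_right: "a *\<^sub>C (x + y) = a *\<^sub>C x + a *\<^sub>C y"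
    and scaleC_add_left: "(a + b) *\<^sub>C x = a *\<^sub>C x + b *\<^sub>C x"
    and scaleC_scaleC: "a *\<^sub>C b *\<^sub>C x = (a * b) *\<^sub>C x"
    and scaleC_one: "1 *\<^sub>C x = x"
    and scaleR_scaleC: "scaleR r x = complex_of_real r *\<^sub>C x"

global_interpretation complex_vector: vector_space "scaleC :: complex \<Rightarrow> 'a \<Rightarrow> 'a::complex_vector"
  defines csubspace = complex_vector.subspace
  by unfold_locales
    (simp_all add: scaleC_add_right scaleC_add_left scaleC_scaleC scaleC_one)

instantiation prod :: (complex_vector, complex_vector) complex_vector
begin

definition scaleC_prod :: "complex \<Rightarrow> 'a \<times> 'b \<Rightarrow> 'a \<times> 'b"
  where "scaleC_prod a p = (a *\<^sub>C fst p, a *\<^sub>C snd p)"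

instance
  by standard
    (simp_all add: scaleC_prod_def prod_eq_iff scaleC_add_right scaleC_add_left
      scaleC_scaleC scaleC_one scaleR_scaleC)

end

text \<open>
  The complex inner product is linear in its first argument. Its real part is the inner product
  of the underlying real inner product space, so that positive definiteness, the norm and the
  topology are inherited from \<open>real_inner\<close>.
\<close>

class complex_inner = complex_vector + real_inner +
  fixes cinner :: "'a \<Rightarrow> 'a \<Rightarrow> complex"
  assumes cinner_commute: "cinner x y = cnj (cinner y x)"
    and cinner_add_left: "cinner (x + y) z = cinner x z + cinner y z"
    and cinner_scaleC_left: "cinner (a *\<^sub>C x) y = a * cinner x y"
    and Re_cinner: "Re (cinner x y) = inner x y"

class chilbert_space = complex_inner + complete_space

instantiation complex :: chilbert_space
begin

definition scaleC_complex :: "complex \<Rightarrow> complex \<Rightarrow> complex"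
  where "scaleC_complex a x = a * x"

definition cinner_complex :: "complex \<Rightarrow> complex \<Rightarrow> complex"
  where "cinner_complex x y = x * cnj y"

instance
  by standard
    (simp_all add: scaleC_complex_def cinner_complex_def inner_complex_def
      algebra_simps scaleR_conv_of_real)

end

definition orth_compl :: "'a::complex_inner set \<Rightarrow> 'a set"
  where "orth_compl S = {x. \<forall>y\<in>S. cinner x y = 0}"

text \<open>Well defined for closed subspaces of a Hilbert space, by the projection theorem.\<close>

definition orth_proj :: "'a::complex_inner set \<Rightarrow> 'a \<Rightarrow> 'a"
  where "orth_proj S h = (THE y. y \<in> S \<and> h - y \<in> orth_compl S)"


section \<open>Linear relations\<close>

text \<open>
  Inverse and product of relations are those of the library: \<open>T\<inverse>\<close> is \<open>converse T\<close>, and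
  the product \<open>R T\<close> (first \<open>T\<close>, then \<open>R\<close>) is \<open>T O R\<close>.
\<close>

definition linear_relation ::
    "'a::complex_vector set \<Rightarrow> 'b::complex_vector set \<Rightarrow> ('a \<times> 'b) set \<Rightarrow> bool"
  where "linear_relation A B T \<longleftrightarrow> T \<subseteq> A \<times> B \<and> csubspace T"

definition graph :: "('a \<Rightarrow> 'b) \<Rightarrow> ('a \<times> 'b) set"
  where "graph f = {(x, f x) | x. True}"

definition neg_rel :: "('a \<times> 'b::uminus) set \<Rightarrow> ('a \<times> 'b) set"
  where "neg_rel T = {(u, - v) | u v. (u, v) \<in> T}"

definition restrict_rel :: "('a \<times> 'b) set \<Rightarrow> 'a set \<Rightarrow> ('a \<times> 'b) set"
  where "restrict_rel T N = {(x, y). (x, y) \<in> T \<and> x \<in> N}"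

definition zero_rel :: "'a set \<Rightarrow> ('a \<times> 'b::zero) set"
  where "zero_rel A = {(x, 0) | x. x \<in> A}"

definition mproj :: "'a::plus set \<Rightarrow> 'a set \<Rightarrow> ('a \<times> 'a) set"
  where "mproj M N = {(m + n, m) | m n. m \<in> M \<and> n \<in> N}"

text \<open>
  The matrix with rows \<open>a, b\<close> and \<open>c, d\<close> with respect to a closed subspace \<open>S\<close>; it is meant for
  linear relations \<open>a\<close> from \<open>S\<close> to \<open>S\<close>, \<open>b\<close> from \<open>orth_compl S\<close> to \<open>S\<close>, \<open>c\<close> from \<open>S\<close> to
  \<open>orth_compl S\<close> and \<open>d\<close> from \<open>orth_compl S\<close> to \<open>orth_compl S\<close>. The subspace enters only through
  these domains and codomains, which is why it is not an argument.
\<close>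

definition block_matrix ::
    "('a::ab_group_add \<times> 'a) set \<Rightarrow> ('a \<times> 'a) set \<Rightarrow> ('a \<times> 'a) set \<Rightarrow> ('a \<times> 'a) set \<Rightarrow> ('a \<times> 'a) set"
  where "block_matrix a b c d =
    {(x1 + x2, (w1 + z1) + (w2 + z2)) | x1 x2 w1 z1 w2 z2.
      (x1, w1) \<in> a \<and> (x2, z1) \<in> b \<and> (x1, w2) \<in> c \<and> (x2, z2) \<in> d}"

end

theory Submission
  imports Defs
begin

text \<open>
  By the projection theorem every \<open>n \<in> N\<close> splits as \<open>n = P n + (n - P n)\<close> with \<open>P\<close> the orthogonal
  projection onto \<open>M\<close>, so \<open>x\<close> consists of the pairs \<open>(n - P n, - P n)\<close>. The two sides then
  correspond under the shift \<open>m \<mapsto> m + P n\<close> of \<open>M\<close>: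
  \<open>(m + n, m) = ((m + P n) + (n - P n), (m + P n) - P n)\<close>.
\<close>

lemma cinner_zero_left [simp]: "cinner 0 (z::'a::complex_inner) = 0"
  using cinner_add_left[of 0 0 z] by simp

lemma cinner_eq_0_commute: "cinner x y = 0 \<longleftrightarrow> cinner y (x::'a::complex_inner) = 0"
  by (metis cinner_commute complex_cnj_zero)

lemma csubspace_scaleR:
  "csubspace S \<Longrightarrow> x \<in> S \<Longrightarrow> r *\<^sub>R x \<in> S"
  by (simp add: scaleR_scaleC complex_vector.subspace_scale)

lemma csubspace_orth_compl: "csubspace (orth_compl S)"
  by (auto simp: complex_vector.subspace_def orth_compl_def cinner_add_left cinner_scaleC_left)

lemma subset_orth_compl_orth_compl: "S \<subseteq> orth_compl (orth_compl S)"
  by (auto simp: orth_compl_def cinner_eq_0_commute)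

lemma csubspace_Int_orth_compl:
  assumes "x \<in> S" "x \<in> orth_compl S"
  shows "x = 0"
proof -
  have "inner x x = 0"
    using assms Re_cinner[of x x] by (simp add: orth_compl_def)
  then show ?thesis by simp
qed

text \<open>Uniqueness: two candidates differ by a vector lying in both \<open>S\<close> and
  \<open>orth_compl S\<close>, hence by 0. This resolves the definite description, so a projection
  is computed by exhibiting its value.\<close>

lemma orth_projI:
  assumes "csubspace S" "y \<in> S" "h - y \<in> orth_compl S"
  shows "orth_proj S h = y"
  unfolding orth_proj_def
proof (rule the_equality)
  fix y' assume y': "y' \<in> S \<and> h - y' \<in> orth_compl S"
  then have "y' - y \<in> S"
    using assms by (simp add: complex_vector.subspace_diff)
  moreover have "y' - y \<in> orth_compl S"
    using complex_vector.subspace_diff[OF csubspace_orth_compl assms(3), of "h - y'"] y' by simp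
  ultimately show "y' = y"
    using csubspace_Int_orth_compl by fastforce
qed (use assms in simp)

text \<open>Variational argument: moving from \<open>y\<close> inside \<open>S\<close> cannot
  shorten the distance to \<open>h\<close>, which forces the real inner products with
  \<open>S\<close> to vanish; complex scaling then handles the imaginary parts.\<close>

lemma orth_compl_if_nearest:
  fixes S :: "'a::complex_inner set"
  assumes "csubspace S" "y \<in> S"
    and nearest: "\<And>z. z \<in> S \<Longrightarrow> norm (h - y) \<le> norm (h - z)"
  shows "h - y \<in> orth_compl S"
proof -
  have real_orth: "inner (h - y) z = 0" if "z \<in> S" for z
  proof (cases "z = 0")
    case False
    \<comment> \<open>This \<open>t\<close> minimises the quadratic
      \<open>norm (h - y - t *\<^sub>R z)\<close> squared, so any nonzero inner product would give a
      strictly nearer point.\<close>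
    define t where "t = inner (h - y) z / inner z z"
    have "y + t *\<^sub>R z \<in> S"
      using assms(1,2) that by (simp add: complex_vector.subspace_add csubspace_scaleR)
    then have "(norm (h - y))\<^sup>2 \<le> (norm (h - y - t *\<^sub>R z))\<^sup>2"
      using nearest[of "y + t *\<^sub>R z"] by (simp add: diff_diff_eq power_mono)
    also have "\<dots> = (norm (h - y))\<^sup>2 - 2 * t * inner (h - y) z + t\<^sup>2 * inner z z"
      using dot_norm_neg[of "h - y" "t *\<^sub>R z"]
      by (simp add: power_mult_distrib power2_norm_eq_inner[of z])
    also have "\<dots> = (norm (h - y))\<^sup>2 - (inner (h - y) z)\<^sup>2 / inner z z"
      using False by (simp add: t_def power2_eq_square)
    finally have "(inner (h - y) z)\<^sup>2 / inner z z \<le> 0" by simp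
    then show ?thesis
      using False inner_gt_zero_iff[of z]
      by (auto simp: divide_le_0_iff simp del: inner_gt_zero_iff)
  qed simp
  have "cinner (h - y) z = 0" if "z \<in> S" for z
  proof (rule complex_eqI)
    show "Re (cinner (h - y) z) = Re 0"
      using real_orth[OF that] by (simp add: Re_cinner)
    \<comment> \<open>Since \<open>S\<close> is a complex subspace, \<open>z\<close> may be replaced
      by its multiple by the imaginary unit. The real part of the resulting product is the imaginary
      part of \<open>cinner (h - y) z\<close>.\<close>
    have "cinner (h - y) (\<i> *\<^sub>C z) = cnj (\<i> * cinner z (h - y))"
      unfolding cinner_scaleC_left[symmetric] by (rule cinner_commute)
    also have "\<dots> = - \<i> * cinner (h - y) z"
      by (subst cinner_commute[of "h - y" z]) simp
    finally have "cinner (h - y) (\<i> *\<^sub>C z) = - \<i> * cinner (h - y) z" .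
    moreover have "Re (cinner (h - y) (\<i> *\<^sub>C z)) = 0"
      using real_orth assms(1) that by (simp add: Re_cinner complex_vector.subspace_scale)
    ultimately show "Im (cinner (h - y) z) = Im 0" by simp
  qed
  then show ?thesis by (simp add: orth_compl_def)
qed

text \<open>A minimising sequence is Cauchy by the parallelogram law; completeness supplies a limit
  and closedness keeps it in \<open>S\<close>.\<close>

lemma nearest_point_exists:
  fixes S :: "'a::chilbert_space set"
  assumes "csubspace S" "closed S"
  obtains y where "y \<in> S" "\<And>z. z \<in> S \<Longrightarrow> norm (h - y) \<le> norm (h - z)"
proof -
  define D where "D = (\<lambda>z. (norm (h - z))\<^sup>2) ` S"
  define d where "d = Inf D"
  have ne: "D \<noteq> {}"
    using complex_vector.subspace_0[OF assms(1)] by (auto simp: D_def)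
  have bdd: "bdd_below D"
    by (auto simp: D_def intro!: bdd_belowI[of _ 0])
  have d_le: "d \<le> (norm (h - z))\<^sup>2" if "z \<in> S" for z
    unfolding d_def by (rule cInf_lower[OF _ bdd]) (use that in \<open>auto simp: D_def\<close>)
  have "\<exists>z\<in>S. (norm (h - z))\<^sup>2 < d + inverse (real (Suc n))" for n
    using cInf_lessD[OF ne, of "d + inverse (real (Suc n))"] by (auto simp: d_def D_def)
  then obtain f where f: "\<And>n. f n \<in> S"
      and f_less: "\<And>n. (norm (h - f n))\<^sup>2 < d + inverse (real (Suc n))"
    by metis
  have f_dist: "(norm (f p - f q))\<^sup>2 \<le> 2 * inverse (real (Suc p)) + 2 * inverse (real (Suc q))"
    for p q
  proof -
    \<comment> \<open>The midpoint lies in \<open>S\<close>, so its squared distance to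
      \<open>h\<close> is at least \<open>d\<close>. In the parallelogram law the resulting
      \<open>4 * d\<close> cancels the two terms \<open>2 * d\<close>, leaving only the
      errors.\<close>
    define m where "m = (1/2) *\<^sub>R (f p + f q)"
    have "m \<in> S"
      using assms(1) f by (simp add: m_def complex_vector.subspace_add csubspace_scaleR)
    have "(norm (f p - f q))\<^sup>2
        = 2 * (norm (h - f p))\<^sup>2 + 2 * (norm (h - f q))\<^sup>2 - 4 * (norm (h - m))\<^sup>2"
    proof -
      have "2 *\<^sub>R (h - m) = (h - f p) + (h - f q)"
        by (simp add: m_def scaleR_right_diff_distrib scaleR_2)
      then have "2 * norm (h - m) = norm ((h - f p) + (h - f q))"
        by (metis norm_scaleR abs_numeral)
      then have "4 * (norm (h - m))\<^sup>2 = (norm ((h - f p) + (h - f q)))\<^sup>2"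
        by (metis four_x_squared)
      moreover have "norm (f p - f q) = norm ((h - f p) - (h - f q))"
        by (simp add: norm_minus_commute)
      \<comment> \<open>Equating the two polarization formulas for the same inner product yields the
        parallelogram law.\<close>
      ultimately show ?thesis
        using dot_norm[of "h - f p" "h - f q"] dot_norm_neg[of "h - f p" "h - f q"] by simp
    qed
    then show ?thesis
      using d_le[OF \<open>m \<in> S\<close>] f_less[of p] f_less[of q] by linarith
  qed
  have "Cauchy f"
  proof (rule metric_CauchyI)
    fix e :: real assume "e > 0"
    then obtain n where n: "inverse (real (Suc n)) < e\<^sup>2 / 4"
      \<comment> \<open>With this bound each of the two terms in \<open>f_dist\<close> is below half
        of the square of \<open>e\<close>.\<close>
      using reals_Archimedean[of "e\<^sup>2 / 4"] by auto
    have "dist (f p) (f q) < e" if "p \<ge> n" "q \<ge> n" for p q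
    proof -
      have "inverse (real (Suc p)) \<le> inverse (real (Suc n))"
        "inverse (real (Suc q)) \<le> inverse (real (Suc n))"
        using that by (simp_all add: le_imp_inverse_le)
      then have "(norm (f p - f q))\<^sup>2 < e\<^sup>2"
        using f_dist[of p q] n by linarith
      then show ?thesis
        using \<open>e > 0\<close> by (simp add: dist_norm power_less_imp_less_base)
    qed
    then show "\<exists>n. \<forall>p\<ge>n. \<forall>q\<ge>n. dist (f p) (f q) < e" by blast
  qed
  then obtain y where y: "f \<longlonglongrightarrow> y"
    using Cauchy_convergent convergent_def by blast
  have "(\<lambda>n. (norm (h - f n))\<^sup>2) \<longlonglongrightarrow> (norm (h - y))\<^sup>2"
    by (intro tendsto_intros y)
  moreover have "(\<lambda>n. d + inverse (real (Suc n))) \<longlonglongrightarrow> d"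
    using tendsto_add[OF tendsto_const[of d] LIMSEQ_inverse_real_of_nat] by simp
  ultimately have y_le: "(norm (h - y))\<^sup>2 \<le> d"
    by (rule LIMSEQ_le) (use f_less less_imp_le in blast)
  have "norm (h - y) \<le> norm (h - z)" if "z \<in> S" for z
    by (rule power2_le_imp_le[OF order_trans[OF y_le d_le[OF that]] norm_ge_zero])
  moreover have "y \<in> S"
    using assms(2) f y closed_sequentially by blast
  ultimately show thesis by (rule that[rotated])
qed

text \<open>The nearest point is a witness for the orthogonal decomposition, and
  \<open>orth_projI\<close> identifies it with \<open>orth_proj S h\<close>.\<close>

lemma
  fixes S :: "'a::chilbert_space set"
  assumes "csubspace S" "closed S"
  shows orth_proj_in: "orth_proj S h \<in> S"
    and diff_orth_proj_in: "h - orth_proj S h \<in> orth_compl S"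
proof -
  obtain y where "y \<in> S" "h - y \<in> orth_compl S"
    using nearest_point_exists[OF assms] orth_compl_if_nearest[OF assms(1)] by metis
  then show "orth_proj S h \<in> S" "h - orth_proj S h \<in> orth_compl S"
    using orth_projI[OF assms(1)] by auto
qed

text \<open>Adding two orthogonal decompositions gives a decomposition of the sum, so uniqueness
  applies. Together with homogeneity this makes \<open>x\<close> a linear relation.\<close>

lemma orth_proj_add:
  fixes S :: "'a::chilbert_space set"
  assumes "csubspace S" "closed S"
  shows "orth_proj S (g + h) = orth_proj S g + orth_proj S h"
proof (rule orth_projI[OF assms(1)])
  show "orth_proj S g + orth_proj S h \<in> S"
    by (intro complex_vector.subspace_add orth_proj_in assms)
  show "g + h - (orth_proj S g + orth_proj S h) \<in> orth_compl S"
    unfolding add_diff_add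
    by (intro complex_vector.subspace_add csubspace_orth_compl diff_orth_proj_in assms)
qed

lemma orth_proj_scaleC:
  fixes S :: "'a::chilbert_space set"
  assumes "csubspace S" "closed S"
  shows "orth_proj S (a *\<^sub>C h) = a *\<^sub>C orth_proj S h"
proof (rule orth_projI[OF assms(1)])
  show "a *\<^sub>C orth_proj S h \<in> S"
    by (intro complex_vector.subspace_scale orth_proj_in assms)
  show "a *\<^sub>C h - a *\<^sub>C orth_proj S h \<in> orth_compl S"
    unfolding complex_vector.scale_right_diff_distrib[symmetric]
    by (intro complex_vector.subspace_scale csubspace_orth_compl diff_orth_proj_in assms)
qed

text \<open>The decomposition of \<open>h\<close> is read with its summands exchanged: the remainder
  \<open>orth_proj S h\<close> lies in \<open>S\<close>, hence in the double complement.\<close>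

lemma orth_proj_orth_compl:
  fixes S :: "'a::chilbert_space set"
  assumes "csubspace S" "closed S"
  shows "orth_proj (orth_compl S) h = h - orth_proj S h"
  using orth_proj_in[OF assms] diff_orth_proj_in[OF assms] subset_orth_compl_orth_compl
  by (intro orth_projI csubspace_orth_compl) auto

theorem proposition3p3:
  fixes M N :: "'h::chilbert_space set"
  assumes "separable_space (euclidean :: 'h topology)"
    and "csubspace M" and "closed M"
    and "csubspace N"
  shows "let x = neg_rel ((restrict_rel (graph (orth_proj (orth_compl M))) N)\<inverse> O graph (orth_proj M))
    in linear_relation (orth_compl M) M x \<and>
       mproj M N = block_matrix (Id_on M) x (zero_rel M) (zero_rel (orth_compl M))"
proof -
  define P where "P = orth_proj M"
  define x where
    "x = neg_rel ((restrict_rel (graph (orth_proj (orth_compl M))) N)\<inverse> O graph (orth_proj M))"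
  note P_in = orth_proj_in[OF assms(2,3), folded P_def]
  note diff_P_in = diff_orth_proj_in[OF assms(2,3), folded P_def]
  note P_add = orth_proj_add[OF assms(2,3), folded P_def]
  note P_scaleC = orth_proj_scaleC[OF assms(2,3), folded P_def]
  \<comment> \<open>The converse leads from \<open>n - P n\<close> back to every such
    \<open>n\<close> in \<open>N\<close>, so \<open>x\<close> is the image of \<open>N\<close> under
    a linear map. It is multivalued exactly when \<open>N\<close> meets \<open>M\<close> outside
    0.\<close>
  have x_eq: "x = (\<lambda>n. (n - P n, - P n)) ` N"
    by (auto simp: x_def neg_rel_def restrict_rel_def graph_def P_def
        orth_proj_orth_compl[OF assms(2,3)])
  have "csubspace x"
    unfolding complex_vector.subspace_def
  proof (intro conjI ballI allI)
    have "P 0 = 0"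
      using P_scaleC[of 0 0] by simp
    then show "0 \<in> x"
      using complex_vector.subspace_0[OF assms(4)]
      unfolding x_eq by (intro image_eqI[of _ _ 0]) (auto simp: zero_prod_def)
  next
    fix u v assume "u \<in> x" "v \<in> x"
    then obtain m n where "m \<in> N" "u = (m - P m, - P m)" "n \<in> N" "v = (n - P n, - P n)"
      by (auto simp: x_eq)
    then show "u + v \<in> x"
      unfolding x_eq
      by (intro image_eqI[of _ _ "m + n"]) (auto simp: P_add complex_vector.subspace_add[OF assms(4)])
  next
    fix a u assume "u \<in> x"
    then obtain n where "n \<in> N" "u = (n - P n, - P n)"
      by (auto simp: x_eq)
    then show "a *\<^sub>C u \<in> x"
      unfolding x_eq
      by (intro image_eqI[of _ _ "a *\<^sub>C n"])
        (auto simp: P_scaleC scaleC_prod_def complex_vector.subspace_scale[OF assms(4)]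
          complex_vector.scale_right_diff_distrib)
  qed
  moreover have "x \<subseteq> orth_compl M \<times> M"
    using P_in diff_P_in complex_vector.subspace_neg[OF assms(2)] by (auto simp: x_eq)
  moreover have "mproj M N = block_matrix (Id_on M) x (zero_rel M) (zero_rel (orth_compl M))"
  proof -
    have "block_matrix (Id_on M) x (zero_rel M) (zero_rel (orth_compl M))
        = {(k + (n - P n), k - P n) | k n. k \<in> M \<and> n \<in> N}"
      (is "_ = ?R")
    proof (intro equalityI subsetI)
      fix z assume "z \<in> ?R"
      \<comment> \<open>The value is spelled out in the shape of \<open>block_matrix\<close>:
        \<open>k\<close> comes from the identity, \<open>- P n\<close> from \<open>x\<close>, and
        both zeros from the lower row.\<close>
      then obtain k n where "z = (k + (n - P n), (k + - P n) + (0 + 0))" "k \<in> M" "n \<in> N"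
        by auto
      then show "z \<in> block_matrix (Id_on M) x (zero_rel M) (zero_rel (orth_compl M))"
        unfolding block_matrix_def zero_rel_def x_eq using diff_P_in by blast
    qed (auto simp: block_matrix_def zero_rel_def x_eq, blast)
    also have "\<dots> = mproj M N"
    proof (intro equalityI subsetI)
      fix z assume "z \<in> ?R"
      then obtain k n where kn: "z = (k + (n - P n), k - P n)" "k \<in> M" "n \<in> N"
        by blast
      then have "z = ((k - P n) + n, k - P n)"
        by simp
      moreover have "k - P n \<in> M"
        by (intro complex_vector.subspace_diff assms(2) kn P_in)
      ultimately show "z \<in> mproj M N"
        unfolding mproj_def using kn(3) by blast
    next
      fix z assume "z \<in> mproj M N"
      then obtain m n where mn: "z = (m + n, m)" "m \<in> M" "n \<in> N"
        unfolding mproj_def by blast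
      then have "z = ((m + P n) + (n - P n), (m + P n) - P n)"
        by simp
      moreover have "m + P n \<in> M"
        by (intro complex_vector.subspace_add assms(2) mn P_in)
      ultimately show "z \<in> ?R"
        using mn(3) by blast
    qed
    finally show ?thesis by simp
  qed
  ultimately show ?thesis
    unfolding x_def[symmetric] Let_def linear_relation_def by blast
qed

end
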